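(* Let $W\in\mathbb{R}^{m\times m}$ be symmetric positive definite, let $\texttt{tol}>0$, let $U_\ell\in\mathbb{R}^{m\times \ell}$, and let $Q\Sigma R^\top$ (with $Q\in\mathbb{R}^{m\times k}$, $\Sigma\in\mathbb{R}^{k\times k}$, $R\in\mathbb{R}^{\ell\times k}$) be a rank-$k$ truncated weighted thin SVD of $U_\ell$. Let $u_{\ell+1},\ldots,u_{\ell+s}\in\mathbb{R}^m$ be incoming columns satisfying $$\|u_{\ell+j}-QQ^\top W u_{\ell+j}\|_W\le \texttt{tol},\qquad j=1,\ldots,s.$$ Define $d_j=Q^\top W u_{\ell+j}\in\mathbb{R}^k$ and the buffer matrix $$Y=[\,\Sigma\mid d_1\mid\cdots\mid d_s\,]\in\mathbb{R}^{k\times(k+s)},$$ and let $Y=\widetilde Q\widetilde\Sigma\widetilde R^\top$ be a thin SVD of $Y$ (so $\widetilde Q,\widetilde\Sigma\in\mathbb{R}^{k\times k}$ and $\widetilde R\in\mathbb{R}^{(k+s)\times k}$). Then, in exact arithmetic, the triple $$Q_{\mathrm{new}}=Q\widetilde Q,\qquad \Sigma_{\mathrm{new}}=\widetilde\Sigma,\qquad R_{\mathrm{new}}=\begin{bmatrix}R&0\\0&I_s\end{bmatrix}\widetilde R$$ agrees, up to the standard SVD ambiguities, with the result of applying $s$ successive rank-non-increasing single-column updates to the initial state $(Q,\Sigma,R)$ with incoming columns $u_{\ell+1},\ldots,u_{\ell+s}$ (in this order).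
   Context: $\|x\|_W=(x^\top W x)^{1/2}$. MATLAB indexing is used, and $[A\mid B]$ denotes horizontal concatenation. Weighted thin SVD: a weighted thin SVD of a matrix $U$ with respect to $W$ is a factorization $U=Q\Sigma R^\top$ with $Q^\top WQ=I$, $R^\top R=I$, $\Sigma=\mathrm{diag}(\sigma_1,\ldots,\sigma_r)$, $\sigma_1\ge\cdots\ge\sigma_r>0$. A rank-$k$ truncated weighted thin SVD has $Q\in\mathbb{R}^{m\times k}$, $R\in\mathbb{R}^{\ell\times k}$, $Q^\top WQ=I_k$, $R^\top R=I_k$, $\Sigma=\mathrm{diag}(\sigma_1,\ldots,\sigma_k)$ with $\sigma_1\ge\cdots\ge\sigma_k>0$; $(Q,\Sigma,R)$ is the running state of the incremental algorithm and $k$ is the running rank. Rank-non-increasing single-column update (Brand's direct incremental update, weighted version): given a state $(Q,\Sigma,R)$ with $Q\in\mathbb{R}^{m\times k}$, $\Sigma\in\mathbb{R}^{k\times k}$, $R\in\mathbb{R}^{\ell\times k}$ and a new column $u$, put $d=Q^\top Wu$. The residual $u-Qd$ is treated as zero, so that the bordered matrix is $\begin{bmatrix}\Sigma&d\\0&0\end{bmatrix}=Q_Y\Sigma_YR_Y^\top$ (its SVD, singular values in nonincreasing order), and the state is replaced by $$Q\leftarrow Q\,Q_Y(1{:}k,1{:}k),\qquad \Sigma\leftarrow\Sigma_Y(1{:}k,1{:}k),\qquad R\leftarrow\begin{bmatrix}R&0\\0&1\end{bmatrix}R_Y(:,1{:}k).$$ Equivalently, if $[\Sigma\mid d]=Q_{(1)}\Sigma_{(1)}R_{(1)}^\top$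 is a thin SVD ($Q_{(1)}\in\mathbb{R}^{k\times k}$ orthogonal), the new state is $\bigl(QQ_{(1)},\ \Sigma_{(1)},\ \begin{bmatrix}R&0\\0&1\end{bmatrix}R_{(1)}\bigr)$. Standard SVD ambiguities: signs of singular vectors and orthogonal rotations within subspaces of repeated singular values. That is, triples $(Q_1,\Sigma_1,R_1)$ and $(Q_2,\Sigma_2,R_2)$ with positive singular values agree up to these ambiguities when $\Sigma_1=\Sigma_2$ and there is an orthogonal $P\in\mathbb{R}^{k\times k}$ commuting with $\Sigma_1$ such that $Q_2=Q_1P$ and $R_2=R_1P$. *)

theory Defs
  imports Complex_Main "Jordan_Normal_Form.Matrix"
begin

definition spd :: "nat \<Rightarrow> real mat \<Rightarrow> bool" where
  "spd m W \<longleftrightarrow> W \<in> carrier_mat m m \<and> W\<^sup>T = W \<and>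
     (\<forall>x\<in>carrier_vec m. x \<noteq> 0\<^sub>v m \<longrightarrow> 0 < x \<bullet> (W *\<^sub>v x))"

definition wnorm :: "real mat \<Rightarrow> real vec \<Rightarrow> real" where
  "wnorm W x = sqrt (x \<bullet> (W *\<^sub>v x))"

(* The MATLAB block A(1:p, 1:q); meaningful for p \<le> dim_row A and q \<le> dim_col A. *)
definition leading_block :: "nat \<Rightarrow> nat \<Rightarrow> real mat \<Rightarrow> real mat" where
  "leading_block p q A = mat p q (\<lambda>ij. A $$ ij)"

(* Horizontal concatenation [A | B]; meaningful for dim_row A = dim_row B. *)
definition hcat :: "real mat \<Rightarrow> real mat \<Rightarrow> real mat" where
  "hcat A B = mat (dim_row A) (dim_col A + dim_col B)
     (\<lambda>(i, j). if j < dim_col A then A $$ (i, j) else B $$ (i, j - dim_col A))"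

definition singular_value_matrix :: "nat \<Rightarrow> real mat \<Rightarrow> bool" where
  "singular_value_matrix r S \<longleftrightarrow>
     (\<exists>\<sigma>. S = mat_diag r \<sigma> \<and> (\<forall>i<r. 0 \<le> \<sigma> i) \<and> (\<forall>i j. i \<le> j \<longrightarrow> j < r \<longrightarrow> \<sigma> j \<le> \<sigma> i))"

definition positive_singular_value_matrix :: "nat \<Rightarrow> real mat \<Rightarrow> bool" where
  "positive_singular_value_matrix r S \<longleftrightarrow>
     singular_value_matrix r S \<and> (\<forall>i<r. 0 < S $$ (i, i))"

(* A factorization (Q, S, R) stands for the product Q S R^T. *)
type_synonym factors = "real mat \<times> real mat \<times> real mat"

definition weighted_thin_svd :: "real mat \<Rightarrow> real mat \<Rightarrow> factors \<Rightarrow> bool" where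
  "weighted_thin_svd W U = (\<lambda>(Q, S, R). \<exists>r.
     Q \<in> carrier_mat (dim_row U) r \<and> R \<in> carrier_mat (dim_col U) r \<and>
     Q\<^sup>T * W * Q = 1\<^sub>m r \<and> R\<^sup>T * R = 1\<^sub>m r \<and>
     positive_singular_value_matrix r S \<and>
     U = Q * S * R\<^sup>T)"

definition thin_svd :: "real mat \<Rightarrow> factors \<Rightarrow> bool" where
  "thin_svd U = weighted_thin_svd (1\<^sub>m (dim_row U)) U"

(* Rank-k truncation: keep the k leading singular triples of a weighted thin SVD of U.
   Here Q S R^T need not equal U, but Q^T W Q = I and R^T R = I are inherited. *)
definition truncated_weighted_thin_svd ::
    "nat \<Rightarrow> real mat \<Rightarrow> real mat \<Rightarrow> factors \<Rightarrow> bool" where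
  "truncated_weighted_thin_svd k W U = (\<lambda>(Q, S, R). \<exists>Qf Sf Rf.
     weighted_thin_svd W U (Qf, Sf, Rf) \<and> k \<le> dim_row Sf \<and>
     Q = leading_block (dim_row Qf) k Qf \<and>
     S = leading_block k k Sf \<and>
     R = leading_block (dim_row Rf) k Rf)"

(* Full SVD of an n \<times> n matrix: zero singular values are allowed. *)
definition square_svd :: "nat \<Rightarrow> real mat \<Rightarrow> factors \<Rightarrow> bool" where
  "square_svd n A = (\<lambda>(Q, S, R).
     Q \<in> carrier_mat n n \<and> R \<in> carrier_mat n n \<and>
     Q\<^sup>T * Q = 1\<^sub>m n \<and> R\<^sup>T * R = 1\<^sub>m n \<and>
     singular_value_matrix n S \<and>
     A = Q * S * R\<^sup>T)"

(* The block diagonal matrix [R 0; 0 I_s]. *)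
definition extend_right :: "nat \<Rightarrow> real mat \<Rightarrow> real mat" where
  "extend_right s R =
     four_block_mat R (0\<^sub>m (dim_row R) s) (0\<^sub>m s (dim_col R)) (1\<^sub>m s)"

(* The update is a relation between the old and the new state, because the SVD of the
   bordered matrix [S d; 0 0] is not unique: every such SVD is admitted. *)
definition single_column_update :: "real mat \<Rightarrow> real vec \<Rightarrow> factors \<Rightarrow> factors \<Rightarrow> bool" where
  "single_column_update W u = (\<lambda>(Q, S, R) (Q', S', R').
     let k = dim_col Q; d = Q\<^sup>T *\<^sub>v (W *\<^sub>v u) in
     \<exists>QY SY RY.
       square_svd (k + 1)
         (four_block_mat S (mat_of_cols k [d]) (0\<^sub>m 1 k) (0\<^sub>m 1 1)) (QY, SY, RY) \<and>
       Q' = Q * leading_block k k QY \<and>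
       S' = leading_block k k SY \<and>
       R' = extend_right 1 R * leading_block (k + 1) k RY)"

fun successive_updates :: "real mat \<Rightarrow> real vec list \<Rightarrow> factors \<Rightarrow> factors \<Rightarrow> bool" where
  "successive_updates W [] st st' \<longleftrightarrow> st' = st"
| "successive_updates W (u # us) st st' \<longleftrightarrow>
     (\<exists>st1. single_column_update W u st st1 \<and> successive_updates W us st1 st')"

definition agree_up_to_svd_ambiguity :: "nat \<Rightarrow> factors \<Rightarrow> factors \<Rightarrow> bool" where
  "agree_up_to_svd_ambiguity k = (\<lambda>(Q1, S1, R1) (Q2, S2, R2).
     dim_col Q1 = k \<and> dim_col R1 = k \<and>
     positive_singular_value_matrix k S1 \<and> S1 = S2 \<and>
     (\<exists>P\<in>carrier_mat k k. P\<^sup>T * P = 1\<^sub>m k \<and> P * S1 = S1 * P \<and>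
        Q2 = Q1 * P \<and> R2 = R1 * P))"

end

theory Submission
  imports Defs "Jordan_Normal_Form.Spectral_Radius"
begin

text \<open>
  Whatever choices the single-column updates make, they end in a state that carries a thin SVD of
  the buffer matrix \<open>Y\<close>; the theorem is then the uniqueness of the thin SVD.

  The left factor of one update is harmless because of the rank: \<open>[S | d]\<close> has full row rank
  \<open>k\<close>, since \<open>S\<close> is diagonal with positive entries. In any SVD of the bordered matrix
  \<open>[S d; 0 0]\<close> the first \<open>k\<close> left singular vectors therefore span the first \<open>k\<close> coordinates and
  the last one is, up to sign, the last unit vector. Cutting off the border leaves a thin SVD
  \<open>[S | d] = A S' B\<^sup>T\<close> with \<open>A\<close> orthogonal (\<open>bordered_svd_leading_part\<close>).

  Updates compose. After the first update the basis is \<open>Q A\<close>, so later columns are seen through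
  \<open>A\<^sup>T Q\<^sup>T W\<close> rather than \<open>Q\<^sup>T W\<close>; as \<open>A\<close> is orthogonal,
  \<open>[S | d\<^sub>1 | D] = A [S' | A\<^sup>T D] diag(B, I)\<^sup>T\<close> (\<open>hcat_factor\<close>). By induction the final state is
  \<open>(Q A, S', diag(R, I) B)\<close> where \<open>Y = A S' B\<^sup>T\<close> is a thin SVD with square \<open>A\<close>
  (\<open>successive_updates_thin_svd\<close>).

  Two thin SVDs of a matrix of full row rank differ only by an orthogonal matrix that commutes
  with the singular values (\<open>full_row_rank_thin_svd_unique\<close>). Multiplying by \<open>Q\<close> and by
  \<open>diag(R, I)\<close> on the left carries this matrix over to the states.

  That some sequence of updates exists requires that every square real matrix has a full SVD
  (\<open>square_svd_exists\<close>). This is shown by splitting off one dominant pair of singular vectors at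
  a time with orthogonal changes of basis on both sides.
\<close>

section \<open>Products, orthogonal matrices and unit vectors\<close>

text \<open>
  Associativity, transposition and cancellation with side conditions on dimensions only. Unlike
  the versions with carrier sets, their premises introduce no new variables, so that the
  simplifier can use them as rewrite rules.
\<close>
lemma mat_mult_assoc_dim:
  fixes A B C :: "'a::semiring_0 mat"
  assumes "dim_col A = dim_row B" "dim_col B = dim_row C"
  shows "(A * B) * C = A * (B * C)"
  using assms by (metis assoc_mult_mat carrier_mat_triv)

lemma mat_transpose_mult_dim:
  fixes A B :: "'a::comm_semiring_0 mat"
  assumes "dim_col A = dim_row B"
  shows "(A * B)\<^sup>T = B\<^sup>T * A\<^sup>T"
  using assms by (metis transpose_mult carrier_mat_triv)

lemma mat_mult_cancel_dim:
  fixes A B X :: "'a::semiring_1 mat"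
  assumes "A * B = 1\<^sub>m n" "dim_col A = dim_row B" "dim_row X = n"
  shows "A * (B * X) = X"
proof -
  have "dim_col B = n" using assms(1) by (metis index_mult_mat(3) index_one_mat(3))
  then have "A * (B * X) = (A * B) * X" using assms(2,3) by (simp add: mat_mult_assoc_dim)
  also have "\<dots> = X" using assms(1,3) by (simp add: left_mult_one_mat')
  finally show ?thesis .
qed

lemmas mat_dim_simps = mat_mult_assoc_dim mat_transpose_mult_dim mat_mult_cancel_dim

lemma transpose_mat_diag: "(mat_diag n f)\<^sup>T = mat_diag n f"
  by (rule eq_matI) (auto simp: mat_diag_def)

lemma orthogonal_right_inverse:
  fixes A :: "real mat"
  assumes "A \<in> carrier_mat n n" "A\<^sup>T * A = 1\<^sub>m n"
  shows "A * A\<^sup>T = 1\<^sub>m n"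
  using mat_mult_left_right_inverse[of "A\<^sup>T" n A] assms by auto

lemma orthogonal_mult:
  fixes A B :: "real mat"
  assumes "A \<in> carrier_mat m n" "B \<in> carrier_mat n r" "A\<^sup>T * A = 1\<^sub>m n" "B\<^sup>T * B = 1\<^sub>m r"
  shows "(A * B)\<^sup>T * (A * B) = 1\<^sub>m r"
  using assms by (auto simp: mat_dim_simps)

lemma scalar_prod_self_nonneg: "0 \<le> (v :: real vec) \<bullet> v"
  by (simp add: scalar_prod_def sum_nonneg)

lemma scalar_prod_self_eq_0:
  fixes v :: "real vec"
  assumes "v \<in> carrier_vec n"
  shows "v \<bullet> v = 0 \<longleftrightarrow> v = 0\<^sub>v n"
proof -
  have "v \<bullet> v = 0 \<longleftrightarrow> (\<forall>i<n. v $ i = 0)"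
    using assms by (auto simp: scalar_prod_def sum_nonneg_eq_0_iff)
  also have "\<dots> \<longleftrightarrow> v = 0\<^sub>v n"
    using assms by (auto intro!: eq_vecI)
  finally show ?thesis .
qed

lemma unit_vector_exists:
  fixes v :: "real vec"
  assumes "v \<in> carrier_vec n" "v \<noteq> 0\<^sub>v n"
  obtains c where "(c \<cdot>\<^sub>v v) \<bullet> (c \<cdot>\<^sub>v v) = 1"
proof -
  have "0 < v \<bullet> v"
    using assms scalar_prod_self_eq_0 scalar_prod_self_nonneg[of v] by (metis less_eq_real_def)
  then have "((1 / sqrt (v \<bullet> v)) \<cdot>\<^sub>v v) \<bullet> ((1 / sqrt (v \<bullet> v)) \<cdot>\<^sub>v v) = 1"
    using assms by (simp add: field_simps)
  then show ?thesis using that by blast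
qed

section \<open>Existence of the singular value decomposition\<close>

text \<open>
  The Householder reflection in the hyperplane orthogonal to \<open>w = v - e\<^sub>0\<close> exchanges \<open>e\<^sub>0\<close> and
  \<open>v\<close>, because the two vectors have the same length.
\<close>
lemma orthogonal_mat_with_first_col:
  fixes v :: "real vec"
  assumes v: "v \<in> carrier_vec (Suc n)" and unit: "v \<bullet> v = 1"
  obtains H where "H \<in> carrier_mat (Suc n) (Suc n)" "H\<^sup>T * H = 1\<^sub>m (Suc n)" "col H 0 = v"
proof (cases "v = unit_vec (Suc n) 0")
  case True
  then show ?thesis using that[of "1\<^sub>m (Suc n)"] by (auto intro!: eq_vecI)
next
  case False
  define w where "w i = v $ i - (if i = 0 then 1 else 0)" for i
  define q where "q = (\<Sum>i<Suc n. w i * w i)"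
  have vv: "(\<Sum>i<Suc n. v $ i * v $ i) = 1"
    using unit v by (simp add: scalar_prod_def lessThan_atLeast0)
  \<comment> \<open>Here the unit length of \<open>v\<close> enters: \<open>w \<bullet> w = 2 - 2 v\<^sub>0 = - 2 w\<^sub>0\<close>.\<close>
  have q_eq: "q = - 2 * w 0"
  proof -
    have "q = (\<Sum>i<Suc n. v $ i * v $ i + (if i = 0 then 1 - 2 * v $ 0 else 0))"
      unfolding q_def by (rule sum.cong) (auto simp: w_def algebra_simps)
    also have "\<dots> = 1 + (\<Sum>i<Suc n. (if i = 0 then 1 - 2 * v $ 0 else 0))"
      unfolding sum.distrib vv ..
    also have "(\<Sum>i<Suc n. (if i = 0 then 1 - 2 * v $ 0 else 0)) = 1 - 2 * v $ 0"
      by (subst sum.delta) auto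
    finally show ?thesis by (simp add: w_def)
  qed
  have "q \<noteq> 0"
  proof
    assume "q = 0"
    then have "\<forall>i<Suc n. w i = 0"
      unfolding q_def by (subst (asm) sum_nonneg_eq_0_iff) auto
    then have "v = unit_vec (Suc n) 0"
      using v by (intro eq_vecI) (auto simp: w_def)
    then show False using False by simp
  qed
  define c where "c = 2 / q"
  define H where "H = mat (Suc n) (Suc n) (\<lambda>(i, j). (if i = j then 1 else 0) - c * w i * w j)"
  have "H\<^sup>T * H = 1\<^sub>m (Suc n)"
  proof (rule eq_matI)
    fix i j assume "i < dim_row (1\<^sub>m (Suc n) :: real mat)" "j < dim_col (1\<^sub>m (Suc n) :: real mat)"
    then have ij: "i < Suc n" "j < Suc n" by auto
    have "(H\<^sup>T * H) $$ (i, j) = (\<Sum>k<Suc n. H $$ (k, i) * H $$ (k, j))"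
      using ij by (simp add: H_def scalar_prod_def lessThan_atLeast0)
    also have "\<dots> = (\<Sum>k<Suc n. (if k = i then (if i = j then 1 else 0) - c * w i * w j else 0)
        + ((if k = j then - c * w i * w j else 0) + c * c * w i * w j * (w k * w k)))"
      by (rule sum.cong) (use ij in \<open>auto simp: H_def algebra_simps\<close>)
    also have "\<dots> = (if i = j then 1 else 0) - 2 * (c * w i * w j) + c * c * w i * w j * q"
      unfolding sum.distrib q_def sum_distrib_left[symmetric]
      using ij by (subst (1 2) sum.delta) auto
    also have "\<dots> = (if i = j then 1 else 0)"
      using \<open>q \<noteq> 0\<close> by (simp add: c_def)
    finally show "(H\<^sup>T * H) $$ (i, j) = 1\<^sub>m (Suc n) $$ (i, j)" using ij by simp
  qed (auto simp: H_def)
  moreover have "c * w 0 = -1"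
    using \<open>q \<noteq> 0\<close> q_eq by (auto simp: c_def field_simps)
  have "col H 0 = v"
  proof (rule eq_vecI)
    fix i assume "i < dim_vec v"
    moreover have "c * w i * w 0 = (c * w 0) * w i" by (simp only: mult.commute mult.left_commute)
    ultimately have "i < Suc n" "c * w i * w 0 = - w i"
      using v \<open>c * w 0 = -1\<close> by auto
    then show "col H 0 $ i = v $ i" by (auto simp: H_def w_def)
  qed (use v in \<open>auto simp: H_def\<close>)
  ultimately show ?thesis using that[of H] by (auto simp: H_def)
qed

text \<open>
  Over the complex numbers an eigenvector \<open>x + i y\<close> exists. Symmetry gives
  \<open>y \<bullet> M x = x \<bullet> M y\<close>, which says that the imaginary part of the eigenvalue times \<open>|x|\<^sup>2 + |y|\<^sup>2\<close>
  vanishes. The eigenvalue is thus real, and \<open>x\<close> or \<open>y\<close> is a real eigenvector.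
\<close>
lemma symmetric_real_eigenvalue_exists:
  fixes M :: "real mat"
  assumes M: "M \<in> carrier_mat n n" and sym: "M\<^sup>T = M" and n: "n > 0"
  shows "\<exists>e. eigenvalue M e"
proof -
  let ?C = "map_mat complex_of_real M"
  have "spectrum ?C \<noteq> {}" by (rule spectrum_non_empty[of _ n]) (use M n in auto)
  then obtain c z where z: "z \<in> carrier_vec n" "z \<noteq> 0\<^sub>v n" "?C *\<^sub>v z = c \<cdot>\<^sub>v z"
    using M by (auto simp: spectrum_def eigenvalue_def eigenvector_def)
  define x where "x = map_vec Re z"
  define y where "y = map_vec Im z"
  have xy: "x \<in> carrier_vec n" "y \<in> carrier_vec n" using z by (auto simp: x_def y_def)
  have comp: "(\<Sum>j<n. of_real (M $$ (i, j)) * z $ j) = c * z $ i" if "i < n" for i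
    using arg_cong[OF z(3), of "\<lambda>v. v $ i"] that z(1) M
    by (simp add: scalar_prod_def lessThan_atLeast0)
  have Mx: "M *\<^sub>v x = Re c \<cdot>\<^sub>v x - Im c \<cdot>\<^sub>v y"
  proof (rule eq_vecI)
    fix i assume "i < dim_vec (Re c \<cdot>\<^sub>v x - Im c \<cdot>\<^sub>v y)"
    then have i: "i < n" using xy by auto
    show "(M *\<^sub>v x) $ i = (Re c \<cdot>\<^sub>v x - Im c \<cdot>\<^sub>v y) $ i"
      using arg_cong[OF comp[OF i], of Re] i M z(1)
      by (simp add: scalar_prod_def lessThan_atLeast0 x_def y_def)
  qed (use M xy in auto)
  have My: "M *\<^sub>v y = Re c \<cdot>\<^sub>v y + Im c \<cdot>\<^sub>v x"
  proof (rule eq_vecI)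
    fix i assume "i < dim_vec (Re c \<cdot>\<^sub>v y + Im c \<cdot>\<^sub>v x)"
    then have i: "i < n" using xy by auto
    show "(M *\<^sub>v y) $ i = (Re c \<cdot>\<^sub>v y + Im c \<cdot>\<^sub>v x) $ i"
      using arg_cong[OF comp[OF i], of Im] i M z(1)
      by (simp add: scalar_prod_def lessThan_atLeast0 x_def y_def)
  qed (use M xy in auto)
  have "y \<bullet> (M *\<^sub>v x) = x \<bullet> (M *\<^sub>v y)"
    using transpose_vec_mult_scalar[OF M xy(1) xy(2)] sym M xy
    by (metis comm_scalar_prod mult_mat_vec_carrier)
  then have "Im c * (x \<bullet> x + y \<bullet> y) = 0"
    unfolding Mx My using xy
    by (simp add: scalar_prod_add_distrib[of _ n] scalar_prod_minus_distrib[of _ n]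
        comm_scalar_prod[of x n y] algebra_simps)
  moreover have "x \<noteq> 0\<^sub>v n \<or> y \<noteq> 0\<^sub>v n"
  proof (rule ccontr)
    assume "\<not> ?thesis"
    then have *: "x = 0\<^sub>v n" "y = 0\<^sub>v n" by auto
    have "z = 0\<^sub>v n"
    proof (rule eq_vecI)
      fix i assume "i < dim_vec (0\<^sub>v n :: complex vec)"
      then have "i < n" by simp
      then have "Re (z $ i) = 0" "Im (z $ i) = 0"
        using arg_cong[OF *(1), of "\<lambda>v. v $ i"] arg_cong[OF *(2), of "\<lambda>v. v $ i"] z(1)
        by (auto simp: x_def y_def)
      then show "z $ i = 0\<^sub>v n $ i" using \<open>i < n\<close> by (simp add: complex_eq_iff)
    qed (use z in auto)
    then show False using z by simp
  qed
  then have "x \<bullet> x + y \<bullet> y \<noteq> 0"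
    using scalar_prod_self_eq_0[OF xy(1)] scalar_prod_self_eq_0[OF xy(2)]
      scalar_prod_self_nonneg[of x] scalar_prod_self_nonneg[of y]
    by linarith
  ultimately have "Im c = 0" by simp
  then have "M *\<^sub>v x = Re c \<cdot>\<^sub>v x" "M *\<^sub>v y = Re c \<cdot>\<^sub>v y"
    using Mx My xy by (auto intro!: eq_vecI)
  then show ?thesis
    using \<open>x \<noteq> 0\<^sub>v n \<or> y \<noteq> 0\<^sub>v n\<close> xy M
    unfolding eigenvalue_def eigenvector_def by auto
qed

lemma scalar_prod_gram:
  fixes B :: "real mat"
  assumes "B \<in> carrier_mat m n" "v \<in> carrier_vec n"
  shows "v \<bullet> (B\<^sup>T * B *\<^sub>v v) = (B *\<^sub>v v) \<bullet> (B *\<^sub>v v)"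
proof -
  have "(B\<^sup>T * B *\<^sub>v v) = B\<^sup>T *\<^sub>v (B *\<^sub>v v)"
    using assms by (intro assoc_mult_mat_vec) auto
  moreover have "(B\<^sup>T *\<^sub>v (B *\<^sub>v v)) \<bullet> v = (B *\<^sub>v v) \<bullet> (B *\<^sub>v v)"
    using transpose_vec_mult_scalar[OF assms, of "B *\<^sub>v v"] assms by auto
  ultimately show ?thesis
    using assms by (metis comm_scalar_prod mult_mat_vec_carrier transpose_carrier_mat)
qed

text \<open>
  Take a unit eigenvector \<open>v\<close> of \<open>B\<^sup>T B\<close> for its largest eigenvalue \<open>e = |B v|\<^sup>2\<close>. If \<open>e > 0\<close>, then
  \<open>u\<close> is \<open>B v\<close> scaled to length one. If \<open>e = 0\<close>, then \<open>B\<close> is singular, hence so is \<open>B\<^sup>T\<close>, and any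
  unit vector in the kernel of \<open>B\<^sup>T\<close> serves as \<open>u\<close>. The maximality of \<open>e\<close> is what later puts the
  singular values in nonincreasing order.
\<close>
lemma dominant_singular_pair:
  fixes B :: "real mat"
  assumes B: "B \<in> carrier_mat n n" and n: "n > 0"
  obtains \<sigma> u v where "0 \<le> \<sigma>"
    "u \<in> carrier_vec n" "u \<bullet> u = 1" "v \<in> carrier_vec n" "v \<bullet> v = 1"
    "B *\<^sub>v v = \<sigma> \<cdot>\<^sub>v u" "B\<^sup>T *\<^sub>v u = \<sigma> \<cdot>\<^sub>v v"
    "\<And>e. eigenvalue (B\<^sup>T * B) e \<Longrightarrow> e \<le> \<sigma>\<^sup>2"
proof -
  let ?M = "B\<^sup>T * B"
  have M: "?M \<in> carrier_mat n n" "?M\<^sup>T = ?M" using B by (auto simp: mat_transpose_mult_dim)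
  have fin: "finite (spectrum ?M)" using card_finite_spectrum[OF M(1)] by simp
  have "spectrum ?M \<noteq> {}"
    using symmetric_real_eigenvalue_exists[OF M n] by (auto simp: spectrum_def)
  define e where "e = Max (spectrum ?M)"
  have e_max: "t \<le> e" if "eigenvalue ?M t" for t
    unfolding e_def using fin that by (intro Max_ge) (auto simp: spectrum_def)
  have "eigenvalue ?M e"
    using Max_in[OF fin \<open>spectrum ?M \<noteq> {}\<close>] by (auto simp: e_def spectrum_def)
  then obtain x where x: "x \<in> carrier_vec n" "x \<noteq> 0\<^sub>v n" "?M *\<^sub>v x = e \<cdot>\<^sub>v x"
    using B by (auto simp: eigenvalue_def eigenvector_def)
  obtain c where c: "(c \<cdot>\<^sub>v x) \<bullet> (c \<cdot>\<^sub>v x) = 1" using unit_vector_exists[OF x(1,2)] .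
  define v where "v = c \<cdot>\<^sub>v x"
  have v: "v \<in> carrier_vec n" "v \<bullet> v = 1" using x c by (auto simp: v_def)
  have Mv: "?M *\<^sub>v v = e \<cdot>\<^sub>v v"
    using x M unfolding v_def by (simp add: mult_mat_vec[OF M(1) x(1)] smult_smult_assoc mult.commute)
  have BBv: "B\<^sup>T *\<^sub>v (B *\<^sub>v v) = e \<cdot>\<^sub>v v"
    using assoc_mult_mat_vec[of "B\<^sup>T" n n B n v] B v Mv by auto
  have norm: "(B *\<^sub>v v) \<bullet> (B *\<^sub>v v) = e"
    using scalar_prod_gram[OF B v(1)] v unfolding Mv by simp
  then have e0: "0 \<le> e" using scalar_prod_self_nonneg[of "B *\<^sub>v v"] by simp
  have Bv: "B *\<^sub>v v \<in> carrier_vec n" using B v by auto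
  show ?thesis
  proof (cases "e = 0")
    case False
    define u where "u = (1 / sqrt e) \<cdot>\<^sub>v (B *\<^sub>v v)"
    have s: "sqrt e \<noteq> 0" "sqrt e * sqrt e = e" using e0 False by auto
    have u: "u \<in> carrier_vec n" using Bv by (simp add: u_def)
    have "u \<bullet> u = 1" unfolding u_def using Bv norm s e0 False by (simp add: field_simps)
    moreover have "B *\<^sub>v v = sqrt e \<cdot>\<^sub>v u"
      using s Bv by (simp add: u_def smult_smult_assoc)
    moreover have "B\<^sup>T *\<^sub>v u = sqrt e \<cdot>\<^sub>v v"
    proof -
      have "B\<^sup>T *\<^sub>v u = (1 / sqrt e) \<cdot>\<^sub>v (e \<cdot>\<^sub>v v)"
        unfolding u_def using mult_mat_vec[of "B\<^sup>T" n n] B Bv BBv by simp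
      then show ?thesis using e0 s by (simp add: smult_smult_assoc real_div_sqrt)
    qed
    ultimately show ?thesis
      using that[of "sqrt e" u v] u v e0 e_max by simp
  next
    case True
    then have "B *\<^sub>v v = 0\<^sub>v n" using norm Bv scalar_prod_self_eq_0 by blast
    then have "det B = 0"
      using det_0_iff_vec_prod_zero[OF B] v by (metis scalar_prod_self_eq_0 zero_neq_one)
    then have "det (B\<^sup>T) = 0" using det_transpose[OF B] by simp
    then obtain y where y: "y \<in> carrier_vec n" "y \<noteq> 0\<^sub>v n" "B\<^sup>T *\<^sub>v y = 0\<^sub>v n"
      using det_0_iff_vec_prod_zero[of "B\<^sup>T" n] B by auto
    obtain c where c: "(c \<cdot>\<^sub>v y) \<bullet> (c \<cdot>\<^sub>v y) = 1" using unit_vector_exists[OF y(1,2)] .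
    have "B\<^sup>T *\<^sub>v (c \<cdot>\<^sub>v y) = 0\<^sub>v n"
      using mult_mat_vec[of "B\<^sup>T" n n y c] B y by (auto intro!: eq_vecI)
    moreover have "0 \<cdot>\<^sub>v x = 0\<^sub>v n" if "x \<in> carrier_vec n" for x :: "real vec"
      using that by (auto intro!: eq_vecI)
    ultimately show ?thesis
      using that[of 0 "c \<cdot>\<^sub>v y" v] v y(1) c \<open>B *\<^sub>v v = 0\<^sub>v n\<close> e_max True by simp
  qed
qed

text \<open>
  If \<open>U\<close> and \<open>V\<close> start with a pair of singular vectors, then \<open>U\<^sup>T B V\<close> has only one nonzero entry in
  its first column. Applied to \<open>B\<close> and to \<open>B\<^sup>T\<close>, this splits off a block of size one.
\<close>
lemma col_deflated:
  fixes B U V :: "real mat"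
  assumes B: "B \<in> carrier_mat n n" and U: "U \<in> carrier_mat n n" "U\<^sup>T * U = 1\<^sub>m n"
    and V: "V \<in> carrier_mat n n" and n: "n > 0"
    and eq: "B *\<^sub>v col V 0 = \<sigma> \<cdot>\<^sub>v col U 0" and i: "i < n"
  shows "(U\<^sup>T * (B * V)) $$ (i, 0) = (if i = 0 then \<sigma> else 0)"
proof -
  have "col (U\<^sup>T * (B * V)) 0 = U\<^sup>T *\<^sub>v (\<sigma> \<cdot>\<^sub>v col U 0)"
    unfolding eq[symmetric] using col_mult2[of "U\<^sup>T" n n "B * V" n 0] col_mult2[OF B V(1) n] B U V n
    by simp
  also have "\<dots> = \<sigma> \<cdot>\<^sub>v (U\<^sup>T *\<^sub>v col U 0)"
    using U n by (intro mult_mat_vec) auto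
  also have "U\<^sup>T *\<^sub>v col U 0 = col (U\<^sup>T * U) 0"
    using col_mult2[of "U\<^sup>T" n n U n 0] U(1) n by simp
  also have "\<dots> = unit_vec n 0" using U n by simp
  finally have "col (U\<^sup>T * (B * V)) 0 = \<sigma> \<cdot>\<^sub>v unit_vec n 0" .
  then have "col (U\<^sup>T * (B * V)) 0 $ i = (\<sigma> \<cdot>\<^sub>v unit_vec n 0) $ i" by simp
  then show ?thesis using U V B i by (simp del: index_mult_mat(1))
qed

text \<open>
  The columns of \<open>R\<close> are eigenvectors of \<open>B\<^sup>T B\<close>. This compares the singular values of the deflated
  block, which are also singular values of \<open>B\<close>, with the dominant one.
\<close>
lemma singular_value_square_eigenvalue:
  fixes B :: "real mat"
  assumes Q: "Q \<in> carrier_mat n n" "Q\<^sup>T * Q = 1\<^sub>m n"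
    and R: "R \<in> carrier_mat n n" "R\<^sup>T * R = 1\<^sub>m n"
    and B: "B = Q * mat_diag n \<sigma> * R\<^sup>T" and i: "i < n"
  shows "eigenvalue (B\<^sup>T * B) ((\<sigma> i)\<^sup>2)"
proof -
  let ?D = "mat_diag n \<sigma>"
  note [simp] = carrier_matD[OF Q(1)] carrier_matD[OF R(1)] carrier_matD[OF mat_diag_dim]
  have "B \<in> carrier_mat n n"
    unfolding B by (rule mult_carrier_mat mat_diag_dim Q(1) | simp add: R(1))+
  then have gram: "B\<^sup>T * B \<in> carrier_mat n n" by simp
  have "B\<^sup>T * B * R = R * (?D * ?D)"
    using Q(2) R(2) by (simp add: B mat_dim_simps transpose_mat_diag)
  also have "\<dots> = mat n n (\<lambda>(i, j). R $$ (i, j) * (\<sigma> j)\<^sup>2)"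
    by (simp add: mat_diag_mult_right[OF R(1)] power2_eq_square)
  finally have "col (B\<^sup>T * B * R) i = (\<sigma> i)\<^sup>2 \<cdot>\<^sub>v col R i"
    using i by (auto intro!: eq_vecI)
  then have "B\<^sup>T * B *\<^sub>v col R i = (\<sigma> i)\<^sup>2 \<cdot>\<^sub>v col R i"
    using col_mult2[OF gram R(1) i] by simp
  moreover have "col R i \<noteq> 0\<^sub>v n"
  proof
    assume *: "col R i = 0\<^sub>v n"
    have "(R\<^sup>T * R) $$ (i, i) = col R i \<bullet> col R i" using i by simp
    then show False using i R(2) * by simp
  qed
  ultimately show ?thesis
    using i R(1) carrier_matD[OF gram] unfolding eigenvalue_def eigenvector_def
    by (intro exI[of _ "col R i"]) simp
qed

text \<open>
  Induction on the size. In bases \<open>U\<close> and \<open>V\<close> that start with the dominant singular pair, \<open>B\<close>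
  becomes block diagonal with blocks \<open>s\<close> and \<open>C'\<close>; an SVD of \<open>C'\<close> is extended by the border and
  transported back.
\<close>
lemma square_svd_exists:
  assumes "B \<in> carrier_mat n n"
  shows "\<exists>Q S R. square_svd n B (Q, S, R)"
proof -
  have "\<exists>Q \<sigma> R. Q \<in> carrier_mat n n \<and> R \<in> carrier_mat n n \<and> Q\<^sup>T * Q = 1\<^sub>m n \<and> R\<^sup>T * R = 1\<^sub>m n \<and>
     (\<forall>i<n. 0 \<le> \<sigma> i) \<and> (\<forall>i j. i \<le> j \<longrightarrow> j < n \<longrightarrow> \<sigma> j \<le> \<sigma> i) \<and> B = Q * mat_diag n \<sigma> * R\<^sup>T"
    using assms
  proof (induction n arbitrary: B)
    case 0
    then show ?case by (auto intro!: exI[of _ "1\<^sub>m 0"] eq_matI)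
  next
    case (Suc n B)
    let ?N = "Suc n"
    note B = Suc.prems
    obtain s u v where pair: "0 \<le> s" "u \<in> carrier_vec ?N" "u \<bullet> u = 1"
      "v \<in> carrier_vec ?N" "v \<bullet> v = 1" "B *\<^sub>v v = s \<cdot>\<^sub>v u" "B\<^sup>T *\<^sub>v u = s \<cdot>\<^sub>v v"
      and dom: "\<And>e. eigenvalue (B\<^sup>T * B) e \<Longrightarrow> e \<le> s\<^sup>2"
      using dominant_singular_pair[OF B] by blast
    obtain U where U: "U \<in> carrier_mat ?N ?N" "U\<^sup>T * U = 1\<^sub>m ?N" "col U 0 = u"
      using orthogonal_mat_with_first_col[OF pair(2,3)] .
    obtain V where V: "V \<in> carrier_mat ?N ?N" "V\<^sup>T * V = 1\<^sub>m ?N" "col V 0 = v"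
      using orthogonal_mat_with_first_col[OF pair(4,5)] .
    note [simp] = carrier_matD[OF U(1)] carrier_matD[OF V(1)] carrier_matD[OF B]
    define C where "C = U\<^sup>T * (B * V)"
    have C: "C \<in> carrier_mat ?N ?N" using U V B by (auto simp: C_def)
    have C_col: "C $$ (i, 0) = (if i = 0 then s else 0)" if "i < ?N" for i
      unfolding C_def by (rule col_deflated) (use B U V pair that in auto)
    have C_tr: "C\<^sup>T = V\<^sup>T * (B\<^sup>T * U)" by (simp add: C_def mat_dim_simps)
    have "C\<^sup>T $$ (i, 0) = (if i = 0 then s else 0)" if "i < ?N" for i
      unfolding C_tr by (rule col_deflated) (use B U V pair that in auto)
    then have C_row: "C $$ (0, i) = (if i = 0 then s else 0)" if "i < ?N" for i
      using C that by fastforce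
    define C' where "C' = mat n n (\<lambda>(i, j). C $$ (Suc i, Suc j))"
    obtain Q' \<sigma>' R' where ih: "Q' \<in> carrier_mat n n" "R' \<in> carrier_mat n n"
      "Q'\<^sup>T * Q' = 1\<^sub>m n" "R'\<^sup>T * R' = 1\<^sub>m n" "\<forall>i<n. 0 \<le> \<sigma>' i"
      "\<forall>i j. i \<le> j \<longrightarrow> j < n \<longrightarrow> \<sigma>' j \<le> \<sigma>' i" "C' = Q' * mat_diag n \<sigma>' * R'\<^sup>T"
      using Suc.IH[of C'] by (auto simp: C'_def)
    define \<sigma> where "\<sigma> = case_nat s \<sigma>'"
    \<comment> \<open>\<open>E X\<close> lets \<open>X\<close> act on all coordinates but the first.\<close>
    define E where "E X = four_block_mat (1\<^sub>m 1) (0\<^sub>m 1 n) (0\<^sub>m n 1) X" for X :: "real mat"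
    have E: "E X \<in> carrier_mat ?N ?N" if "X \<in> carrier_mat n n" for X
      using four_block_carrier_mat[of "1\<^sub>m 1" 1 1 X n n] that unfolding E_def by auto
    have E_orth: "(E X)\<^sup>T * E X = 1\<^sub>m ?N" if "X \<in> carrier_mat n n" "X\<^sup>T * X = 1\<^sub>m n" for X
    proof -
      have "(E X)\<^sup>T = four_block_mat (1\<^sub>m 1) (0\<^sub>m 1 n) (0\<^sub>m n 1) (X\<^sup>T)"
        unfolding E_def using that by (subst transpose_four_block_mat[of _ 1 1 _ n _ n]) auto
      then show ?thesis
        unfolding E_def using that
        by (simp add: mult_four_block_mat[of _ 1 1 _ n _ n _ _ 1 _ n])
    qed
    have "mat_diag ?N \<sigma> = four_block_mat (mat 1 1 (\<lambda>_. s)) (0\<^sub>m 1 n) (0\<^sub>m n 1) (mat_diag n \<sigma>')"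
      by (rule eq_matI) (auto simp: mat_diag_def \<sigma>_def split: nat.split)
    moreover have "(E R')\<^sup>T = four_block_mat (1\<^sub>m 1) (0\<^sub>m 1 n) (0\<^sub>m n 1) (R'\<^sup>T)"
      unfolding E_def using ih by (subst transpose_four_block_mat[of _ 1 1 _ n _ n]) auto
    moreover have QD: "Q' * mat_diag n \<sigma>' \<in> carrier_mat n n"
      and QDR: "Q' * mat_diag n \<sigma>' * R'\<^sup>T \<in> carrier_mat n n"
      by (rule mult_carrier_mat mat_diag_dim ih(1) | simp add: ih(2))+
    ultimately have "E Q' * mat_diag ?N \<sigma> * (E R')\<^sup>T
        = four_block_mat (mat 1 1 (\<lambda>_. s)) (0\<^sub>m 1 n) (0\<^sub>m n 1) C'"
      using ih(1,2)
      by (simp add: E_def mult_four_block_mat[of _ 1 1 _ n _ n _ _ 1 _ n] ih(7)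
          left_mult_zero_mat[OF mat_diag_dim] right_mult_zero_mat[OF QD] left_add_zero_mat[OF QDR]
          del: One_nat_def)
    also have "\<dots> = C"
      using C C_row C_col by (intro eq_matI) (auto simp: C'_def)
    finally have C_svd: "C = E Q' * mat_diag ?N \<sigma> * (E R')\<^sup>T" ..
    define Q where "Q = U * E Q'"
    define R where "R = V * E R'"
    have Q: "Q \<in> carrier_mat ?N ?N" "Q\<^sup>T * Q = 1\<^sub>m ?N"
      unfolding Q_def using orthogonal_mult[OF U(1) E[OF ih(1)] U(2) E_orth] ih U E by auto
    have R: "R \<in> carrier_mat ?N ?N" "R\<^sup>T * R = 1\<^sub>m ?N"
      unfolding R_def using orthogonal_mult[OF V(1) E[OF ih(2)] V(2) E_orth] ih V E by auto
    note [simp] = carrier_matD[OF E[OF ih(1)]] carrier_matD[OF E[OF ih(2)]] carrier_matD[OF mat_diag_dim]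
    have "U * C * V\<^sup>T = B"
      unfolding C_def using orthogonal_right_inverse[OF U(1,2)] orthogonal_right_inverse[OF V(1,2)]
      by (simp add: mat_dim_simps)
    then have B_svd: "B = Q * mat_diag ?N \<sigma> * R\<^sup>T"
      by (simp add: C_svd Q_def R_def mat_dim_simps)
    have "\<sigma>' i \<le> s" if "i < n" for i
    proof -
      have "(\<sigma>' i)\<^sup>2 \<le> s\<^sup>2"
        using dom[OF singular_value_square_eigenvalue[OF Q R B_svd, of "Suc i"]] that
        by (simp add: \<sigma>_def)
      then show ?thesis using pair(1) by (rule power2_le_imp_le)
    qed
    then have "\<forall>i j. i \<le> j \<longrightarrow> j < ?N \<longrightarrow> \<sigma> j \<le> \<sigma> i"
      using ih(6) by (auto simp: \<sigma>_def split: nat.splits)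
    moreover have "\<forall>i<?N. 0 \<le> \<sigma> i" using ih(5) pair(1) by (auto simp: \<sigma>_def split: nat.splits)
    ultimately show ?case using Q R B_svd by blast
  qed
  then obtain Q \<sigma> R where *: "Q \<in> carrier_mat n n" "R \<in> carrier_mat n n" "Q\<^sup>T * Q = 1\<^sub>m n"
    "R\<^sup>T * R = 1\<^sub>m n" "\<forall>i<n. 0 \<le> \<sigma> i" "\<forall>i j. i \<le> j \<longrightarrow> j < n \<longrightarrow> \<sigma> j \<le> \<sigma> i"
    "B = Q * mat_diag n \<sigma> * R\<^sup>T"
    by metis
  from *(5,6) have "singular_value_matrix n (mat_diag n \<sigma>)" unfolding singular_value_matrix_def by blast
  with * have "square_svd n B (Q, mat_diag n \<sigma>, R)" unfolding square_svd_def by simp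
  then show ?thesis by blast
qed

section \<open>Singular value matrices and block operations\<close>

lemma positive_singular_value_matrixE:
  assumes "positive_singular_value_matrix k S"
  obtains \<sigma> where "S = mat_diag k \<sigma>" "\<And>i. i < k \<Longrightarrow> 0 < \<sigma> i"
    "\<And>i j. i \<le> j \<Longrightarrow> j < k \<Longrightarrow> \<sigma> j \<le> \<sigma> i"
  using assms unfolding positive_singular_value_matrix_def singular_value_matrix_def mat_diag_def
  by fastforce

lemma positive_singular_value_matrix_carrier:
  "positive_singular_value_matrix k S \<Longrightarrow> S \<in> carrier_mat k k"
  by (metis positive_singular_value_matrixE mat_diag_dim)

lemma positive_singular_value_matrixI:
  assumes "S = mat_diag k \<sigma>" "\<And>i. i < k \<Longrightarrow> 0 < \<sigma> i"
    "\<And>i j. i \<le> j \<Longrightarrow> j < k \<Longrightarrow> \<sigma> j \<le> \<sigma> i"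
  shows "positive_singular_value_matrix k S"
proof -
  have "S $$ (i, i) = \<sigma> i" if "i < k" for i using that by (simp add: assms(1) mat_diag_def)
  then show ?thesis
    unfolding positive_singular_value_matrix_def singular_value_matrix_def
    using assms less_imp_le[OF assms(2)] by metis
qed

lemma leading_block_carrier [simp]: "leading_block p q A \<in> carrier_mat p q"
  by (simp add: leading_block_def)

lemma leading_block_index [simp]: "i < p \<Longrightarrow> j < q \<Longrightarrow> leading_block p q A $$ (i, j) = A $$ (i, j)"
  by (simp add: leading_block_def)

lemma leading_block_mat_diag: "q \<le> n \<Longrightarrow> leading_block q q (mat_diag n \<sigma>) = mat_diag q \<sigma>"
  by (rule eq_matI) (auto simp: leading_block_def mat_diag_def)

lemma positive_singular_value_matrix_leading_block:
  assumes "positive_singular_value_matrix r S" "k \<le> dim_row S"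
  shows "positive_singular_value_matrix k (leading_block k k S)"
proof -
  obtain \<sigma> where \<sigma>: "S = mat_diag r \<sigma>" "\<And>i. i < r \<Longrightarrow> 0 < \<sigma> i"
    "\<And>i j. i \<le> j \<Longrightarrow> j < r \<Longrightarrow> \<sigma> j \<le> \<sigma> i"
    using positive_singular_value_matrixE[OF assms(1)] by blast
  have "k \<le> r" using assms(2) carrier_matD(1)[OF mat_diag_dim[of r \<sigma>]] by (simp add: \<sigma>(1))
  then have "leading_block k k S = mat_diag k \<sigma>" unfolding \<sigma>(1) by (rule leading_block_mat_diag)
  then show ?thesis
    by (rule positive_singular_value_matrixI) (use \<open>k \<le> r\<close> \<sigma>(2,3) less_le_trans in blast)+
qed

lemma extend_right_carrier: "R \<in> carrier_mat l k \<Longrightarrow> extend_right s R \<in> carrier_mat (l + s) (k + s)"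
  by (auto simp: extend_right_def)

lemma extend_right_transpose: "(extend_right s B)\<^sup>T = extend_right s (B\<^sup>T)"
  unfolding extend_right_def
  by (subst transpose_four_block_mat[of _ "dim_row B" "dim_col B" _ s _ s]) auto

lemma extend_right_mult:
  assumes "A \<in> carrier_mat a b" "B \<in> carrier_mat b c"
  shows "extend_right s (A * B) = extend_right s A * extend_right s B"
  unfolding extend_right_def using assms mult_carrier_mat[OF assms]
  by (subst mult_four_block_mat[of _ a b _ s _ s _ _ c _ s]) auto

lemma extend_right_one: "extend_right s (1\<^sub>m k) = 1\<^sub>m (k + s)"
  by (simp add: extend_right_def)

lemma extend_right_orthonormal:
  assumes "B \<in> carrier_mat n k" "B\<^sup>T * B = 1\<^sub>m k"
  shows "(extend_right s B)\<^sup>T * extend_right s B = 1\<^sub>m (k + s)"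
  using assms extend_right_mult[of "B\<^sup>T" k n B k s]
  by (simp add: extend_right_transpose extend_right_one)

lemma extend_right_extend_right: "extend_right s (extend_right t R) = extend_right (t + s) R"
  by (rule eq_matI) (auto simp: extend_right_def)

lemma extend_right_0: "extend_right 0 R = R"
  by (rule eq_matI) (auto simp: extend_right_def)

text \<open>
  Seeing horizontal concatenation as a four block matrix without lower blocks makes block
  multiplication available for it.
\<close>
lemma hcat_four_block:
  "hcat A B = four_block_mat A B (0\<^sub>m 0 (dim_col A)) (0\<^sub>m 0 (dim_col B))"
  by (rule eq_matI) (auto simp: hcat_def)

lemma hcat_mult_extend_right:
  assumes "S \<in> carrier_mat k q" "B \<in> carrier_mat n q" "D \<in> carrier_mat k s"
  shows "hcat S D * (extend_right s B)\<^sup>T = hcat (S * B\<^sup>T) D"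
  unfolding extend_right_transpose unfolding hcat_four_block extend_right_def
  using assms mult_carrier_mat[of S k q "B\<^sup>T" n]
  by (subst mult_four_block_mat[of _ k q _ s _ 0 _ _ n _ s]) auto

lemma mult_hcat:
  assumes "A \<in> carrier_mat p k" "S \<in> carrier_mat k q" "D \<in> carrier_mat k s"
  shows "A * hcat S D = hcat (A * S) (A * D)"
proof (rule eq_matI)
  fix i j assume "i < dim_row (hcat (A * S) (A * D))" "j < dim_col (hcat (A * S) (A * D))"
  then have ij: "i < p" "j < q + s" using assms by (auto simp: hcat_def)
  have "col (hcat S D) j = (if j < q then col S j else col D (j - q))"
    using ij assms by (auto simp: hcat_def intro!: eq_vecI)
  then show "(A * hcat S D) $$ (i, j) = hcat (A * S) (A * D) $$ (i, j)"
    using ij assms by (auto simp: hcat_def)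
qed (use assms in \<open>auto simp: hcat_def\<close>)

text \<open>
  The step that composes a factorization of the old columns with the treatment of the new ones:
  as \<open>A\<close> is orthogonal, it can be pulled out of \<open>D\<close> as well, and \<open>B\<close> is padded by an identity so
  that it leaves the new columns alone.
\<close>
lemma hcat_factor:
  assumes A: "A \<in> carrier_mat k k" "A\<^sup>T * A = 1\<^sub>m k" and S: "S \<in> carrier_mat k q"
    and B: "B \<in> carrier_mat n q" and D: "D \<in> carrier_mat k s"
  shows "hcat (A * S * B\<^sup>T) D = A * hcat S (A\<^sup>T * D) * (extend_right s B)\<^sup>T"
proof -
  have "A * (A\<^sup>T * D) = D"
    using mat_mult_cancel_dim[OF orthogonal_right_inverse[OF A], of D] A D by auto
  then have "A * hcat S (A\<^sup>T * D) = hcat (A * S) D"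
    using mult_hcat[OF A(1) S, of "A\<^sup>T * D" s] A D by auto
  then show ?thesis using hcat_mult_extend_right[of "A * S" k q B n D s] A S B D by auto
qed

lemma hcat_cons:
  assumes "S \<in> carrier_mat k q"
  shows "hcat S (mat_of_cols k (d # ds)) = hcat (hcat S (mat_of_cols k [d])) (mat_of_cols k ds)"
  using assms
  by (intro eq_matI)
    (auto simp: hcat_def mat_of_cols_def nth_Cons' split: if_splits)

section \<open>One update\<close>

text \<open>
  Write \<open>M\<close> for the bordered matrix. Comparing entries in \<open>QY\<^sup>T M = SY RY\<^sup>T\<close> shows that a left singular
  vector with singular value zero is a multiple of the last unit vector, as the diagonal entries of
  \<open>S\<close> are positive. Two orthonormal vectors cannot both be of this form, so only the last singular
  value can vanish. Comparing the last rows of \<open>M RY = QY SY\<close> shows that the other left singular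
  vectors have last entry zero. Hence the last row of \<open>QY\<close> is a unit vector up to sign, the last
  singular value does vanish, and deleting the border loses neither orthonormality nor any part of
  the product.
\<close>
lemma bordered_svd_leading_part:
  assumes svd: "square_svd (k + 1) (four_block_mat S D (0\<^sub>m 1 k) (0\<^sub>m 1 1)) (QY, SY, RY)"
    and S: "positive_singular_value_matrix k S" and D: "D \<in> carrier_mat k 1"
  defines "A \<equiv> leading_block k k QY" and "T \<equiv> leading_block k k SY"
    and "B \<equiv> leading_block (k + 1) k RY"
  shows "A\<^sup>T * A = 1\<^sub>m k" "B\<^sup>T * B = 1\<^sub>m k" "positive_singular_value_matrix k T"
    "hcat S D = A * T * B\<^sup>T"
proof -
  let ?N = "k + 1"
  define M where "M = four_block_mat S D (0\<^sub>m 1 k) (0\<^sub>m 1 1)"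
  obtain s where s: "S = mat_diag k s" "\<And>i. i < k \<Longrightarrow> 0 < s i"
    using positive_singular_value_matrixE[OF S] by blast
  obtain \<sigma> where \<sigma>: "SY = mat_diag ?N \<sigma>" "\<And>i. i < ?N \<Longrightarrow> 0 \<le> \<sigma> i"
    "\<And>i j. i \<le> j \<Longrightarrow> j < ?N \<Longrightarrow> \<sigma> j \<le> \<sigma> i"
    using svd by (auto simp: square_svd_def singular_value_matrix_def)
  have Q: "QY \<in> carrier_mat ?N ?N" "QY\<^sup>T * QY = 1\<^sub>m ?N"
    and R: "RY \<in> carrier_mat ?N ?N" "RY\<^sup>T * RY = 1\<^sub>m ?N"
    and M_svd: "M = QY * SY * RY\<^sup>T"
    using svd by (auto simp: square_svd_def M_def)
  have S_carrier: "S \<in> carrier_mat k k" and SY_carrier: "SY \<in> carrier_mat ?N ?N"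
    unfolding s(1) \<sigma>(1) by (rule mat_diag_dim)+
  note [simp] = carrier_matD[OF Q(1)] carrier_matD[OF R(1)] carrier_matD[OF S_carrier]
    carrier_matD[OF SY_carrier] carrier_matD[OF D]
  have M_dim [simp]: "dim_row M = ?N" "dim_col M = ?N" by (simp_all add: M_def)
  have Q_col: "(\<Sum>p<k. QY $$ (p, i) * QY $$ (p, j)) + QY $$ (k, i) * QY $$ (k, j)
      = (if i = j then 1 else 0)" if "i < ?N" "j < ?N" for i j
    using arg_cong[OF Q(2), of "\<lambda>X. X $$ (i, j)"] that
    by (simp add: scalar_prod_def lessThan_atLeast0)
  have R_col: "(\<Sum>p<?N. RY $$ (p, i) * RY $$ (p, j)) = (if i = j then 1 else 0)"
    if "i < ?N" "j < ?N" for i j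
    using arg_cong[OF R(2), of "\<lambda>X. X $$ (i, j)"] that
    by (simp add: scalar_prod_def lessThan_atLeast0)
  have left: "QY $$ (l, i) * s l = \<sigma> i * RY $$ (l, i)" if "i < ?N" "l < k" for i l
  proof -
    have "QY\<^sup>T * M = SY * RY\<^sup>T"
      using Q(2) by (simp add: M_svd mat_dim_simps)
    then have "(QY\<^sup>T * M) $$ (i, l) = (SY * RY\<^sup>T) $$ (i, l)" by simp
    also have "\<dots> = \<sigma> i * RY $$ (l, i)"
      using that mat_diag_mult_left[of "RY\<^sup>T" ?N ?N \<sigma>] R(1) by (simp add: \<sigma>(1))
    also have "(QY\<^sup>T * M) $$ (i, l) = (\<Sum>p<k. QY $$ (p, i) * (if p = l then s l else 0))"
      using that by (simp add: scalar_prod_def lessThan_atLeast0 M_def s(1) mat_diag_def)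
    also have "\<dots> = QY $$ (l, i) * s l" using that by (simp add: sum.delta if_distrib cong: if_cong)
    finally show ?thesis .
  qed
  have last_row: "QY $$ (k, i) * \<sigma> i = 0" if "i < ?N" for i
  proof -
    have "M * RY = QY * SY"
      using R(2) by (simp add: M_svd mat_dim_simps)
    then have "(M * RY) $$ (k, i) = (QY * SY) $$ (k, i)" by simp
    also have "\<dots> = QY $$ (k, i) * \<sigma> i"
      using that mat_diag_mult_right[OF Q(1), of \<sigma>] by (simp add: \<sigma>(1))
    also have "(M * RY) $$ (k, i) = 0"
      using that by (simp add: scalar_prod_def M_def)
    finally show ?thesis by simp
  qed
  have null_col: "QY $$ (l, i) = 0" if "i < ?N" "\<sigma> i = 0" "l < k" for i l
    using left[OF that(1,3)] s(2)[OF that(3)] that(2) by simp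
  have pos: "0 < \<sigma> i" if i: "i < k" for i
  proof (rule ccontr)
    assume "\<not> 0 < \<sigma> i"
    then have zero: "\<sigma> i = 0" "\<sigma> k = 0" using \<sigma>(2)[of i] \<sigma>(2)[of k] \<sigma>(3)[of i k] i by auto
    have "QY $$ (k, i) * QY $$ (k, i) = 1" "QY $$ (k, k) * QY $$ (k, k) = 1"
      "QY $$ (k, i) * QY $$ (k, k) = 0"
      using Q_col[of i i] Q_col[of k k] Q_col[of i k] null_col[of i] null_col[of k] zero i by auto
    then show False by auto
  qed
  have border: "QY $$ (k, i) = 0" if "i < k" for i
    using last_row[of i] pos[OF that] that by simp
  have "\<sigma> k = 0"
  proof -
    have "(QY * QY\<^sup>T) $$ (k, k) = (\<Sum>p<?N. QY $$ (k, p) * QY $$ (k, p))"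
      by (simp add: scalar_prod_def lessThan_atLeast0)
    then have "QY $$ (k, k) * QY $$ (k, k) = 1"
      using orthogonal_right_inverse[OF Q] border by simp
    then show ?thesis using last_row[of k] by auto
  qed
  have T: "T = mat_diag k \<sigma>" by (simp add: T_def \<sigma>(1) leading_block_mat_diag)
  show "positive_singular_value_matrix k T"
    by (rule positive_singular_value_matrixI[OF T pos \<sigma>(3)]) simp_all
  note [simp] = carrier_matD[OF leading_block_carrier]
  show "A\<^sup>T * A = 1\<^sub>m k"
  proof (rule eq_matI)
    fix i j assume "i < dim_row (1\<^sub>m k :: real mat)" "j < dim_col (1\<^sub>m k :: real mat)"
    then show "(A\<^sup>T * A) $$ (i, j) = 1\<^sub>m k $$ (i, j)"
      using Q_col[of i j] border by (simp add: A_def scalar_prod_def lessThan_atLeast0)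
  qed (simp_all add: A_def)
  show "B\<^sup>T * B = 1\<^sub>m k"
  proof (rule eq_matI)
    fix i j assume "i < dim_row (1\<^sub>m k :: real mat)" "j < dim_col (1\<^sub>m k :: real mat)"
    then show "(B\<^sup>T * B) $$ (i, j) = 1\<^sub>m k $$ (i, j)"
      using R_col[of i j] by (simp add: B_def scalar_prod_def lessThan_atLeast0)
  qed (simp_all add: B_def)
  show "hcat S D = A * T * B\<^sup>T"
  proof (rule eq_matI)
    fix i j assume "i < dim_row (A * T * B\<^sup>T)" "j < dim_col (A * T * B\<^sup>T)"
    then have ij: "i < k" "j < ?N" by (simp_all add: A_def B_def)
    have "hcat S D $$ (i, j) = M $$ (i, j)"
      using ij by (auto simp: hcat_def M_def)
    also have "\<dots> = (\<Sum>p<?N. QY $$ (i, p) * \<sigma> p * RY $$ (j, p))"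
      unfolding M_svd \<sigma>(1) mat_diag_mult_right[OF Q(1)]
      using ij by (simp add: scalar_prod_def lessThan_atLeast0)
    also have "\<dots> = (\<Sum>p<k. QY $$ (i, p) * \<sigma> p * RY $$ (j, p))"
      using \<open>\<sigma> k = 0\<close> by simp
    also have "\<dots> = (A * T * B\<^sup>T) $$ (i, j)"
      unfolding A_def T mat_diag_mult_right[OF leading_block_carrier]
      using ij by (simp add: scalar_prod_def lessThan_atLeast0 B_def)
    finally show "hcat S D $$ (i, j) = (A * T * B\<^sup>T) $$ (i, j)" .
  qed (simp_all add: A_def B_def hcat_four_block)
qed

lemma single_column_update_thin_svd:
  assumes upd: "single_column_update W u (Q, S, R) (Q', S', R')"
    and Q: "Q \<in> carrier_mat m k" and S: "positive_singular_value_matrix k S"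
  obtains A B where "A \<in> carrier_mat k k" "A\<^sup>T * A = 1\<^sub>m k" "B \<in> carrier_mat (k + 1) k"
    "B\<^sup>T * B = 1\<^sub>m k" "positive_singular_value_matrix k S'"
    "hcat S (mat_of_cols k [Q\<^sup>T *\<^sub>v (W *\<^sub>v u)]) = A * S' * B\<^sup>T"
    "Q' = Q * A" "R' = extend_right 1 R * B"
proof -
  let ?D = "mat_of_cols k [Q\<^sup>T *\<^sub>v (W *\<^sub>v u)]"
  have D: "?D \<in> carrier_mat k 1" using mat_of_cols_carrier(1)[of k "[Q\<^sup>T *\<^sub>v (W *\<^sub>v u)]"] by simp
  have "dim_col Q = k" using Q by simp
  then obtain QY SY RY where
    svd: "square_svd (k + 1) (four_block_mat S ?D (0\<^sub>m 1 k) (0\<^sub>m 1 1)) (QY, SY, RY)"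
    and new: "Q' = Q * leading_block k k QY" "S' = leading_block k k SY"
      "R' = extend_right 1 R * leading_block (k + 1) k RY"
    using upd unfolding single_column_update_def Let_def by auto
  show thesis
    by (rule that[OF leading_block_carrier _ leading_block_carrier _ _ _ new(1,3)])
      (simp_all only: new(2) bordered_svd_leading_part[OF svd S D])
qed

lemma single_column_update_exists:
  assumes "Q \<in> carrier_mat m k" "S \<in> carrier_mat k k"
  shows "\<exists>st. single_column_update W u (Q, S, R) st"
proof -
  let ?M = "four_block_mat S (mat_of_cols k [Q\<^sup>T *\<^sub>v (W *\<^sub>v u)]) (0\<^sub>m 1 k) (0\<^sub>m 1 1)"
  have "?M \<in> carrier_mat (k + 1) (k + 1)" using assms by auto
  then obtain QY SY RY where "square_svd (k + 1) ?M (QY, SY, RY)" using square_svd_exists by blast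
  moreover have "dim_col Q = k" using assms by simp
  ultimately show ?thesis
    unfolding single_column_update_def Let_def split_paired_Ex case_prod_conv by blast
qed

section \<open>Successive updates\<close>

text \<open>
  Turning the basis from \<open>Q\<close> to \<open>Q A\<close> turns the coefficients of the incoming columns by \<open>A\<^sup>T\<close>.
\<close>
lemma transpose_mult_mat_of_cols:
  fixes A Q W :: "real mat"
  assumes "A \<in> carrier_mat k k" "Q \<in> carrier_mat m k" "\<And>u. u \<in> set us \<Longrightarrow> W *\<^sub>v u \<in> carrier_vec m"
  shows "A\<^sup>T * mat_of_cols k (map (\<lambda>u. Q\<^sup>T *\<^sub>v (W *\<^sub>v u)) us) =
    mat_of_cols k (map (\<lambda>u. (Q * A)\<^sup>T *\<^sub>v (W *\<^sub>v u)) us)"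
proof (rule eq_matI)
  fix i j
  assume "i < dim_row (mat_of_cols k (map (\<lambda>u. (Q * A)\<^sup>T *\<^sub>v (W *\<^sub>v u)) us))"
    "j < dim_col (mat_of_cols k (map (\<lambda>u. (Q * A)\<^sup>T *\<^sub>v (W *\<^sub>v u)) us))"
  then have ij: "i < k" "j < length us" by auto
  let ?w = "W *\<^sub>v us ! j"
  have w: "?w \<in> carrier_vec m" using assms(3) ij by simp
  have "(Q * A)\<^sup>T *\<^sub>v ?w = A\<^sup>T *\<^sub>v (Q\<^sup>T *\<^sub>v ?w)"
    unfolding transpose_mult[OF assms(2,1)]
    by (rule assoc_mult_mat_vec) (use assms(1,2) w in auto)
  moreover have "col (mat_of_cols k (map (\<lambda>u. Q\<^sup>T *\<^sub>v (W *\<^sub>v u)) us)) j = Q\<^sup>T *\<^sub>v ?w"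
    using ij assms w by (subst col_mat_of_cols) auto
  ultimately show "(A\<^sup>T * mat_of_cols k (map (\<lambda>u. Q\<^sup>T *\<^sub>v (W *\<^sub>v u)) us)) $$ (i, j) =
    mat_of_cols k (map (\<lambda>u. (Q * A)\<^sup>T *\<^sub>v (W *\<^sub>v u)) us) $$ (i, j)"
    using ij assms by (simp add: mat_of_cols_index del: transpose_mult)
qed (use assms in auto)

text \<open>
  Induction from the front of the list: the first update factors \<open>[S | d]\<close>, the induction
  hypothesis factors \<open>[S1 | A\<^sup>T D]\<close> for the turned coefficients \<open>A\<^sup>T D\<close> of the remaining columns,
  and \<open>hcat_factor\<close> combines the two. The right factors accumulate by the same padding, since
  \<open>diag(diag(R, 1) B, I) = diag(R, I) diag(B, I)\<close>.
\<close>
lemma successive_updates_thin_svd: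
  assumes "successive_updates W us (Q, S, R) st"
    and "W \<in> carrier_mat m m" "Q \<in> carrier_mat m k" "R \<in> carrier_mat l k"
    and "positive_singular_value_matrix k S" "\<And>u. u \<in> set us \<Longrightarrow> u \<in> carrier_vec m"
  shows "\<exists>A S' B. st = (Q * A, S', extend_right (length us) R * B) \<and>
    A \<in> carrier_mat k k \<and> A\<^sup>T * A = 1\<^sub>m k \<and> B \<in> carrier_mat (k + length us) k \<and> B\<^sup>T * B = 1\<^sub>m k \<and>
    positive_singular_value_matrix k S' \<and>
    hcat S (mat_of_cols k (map (\<lambda>u. Q\<^sup>T *\<^sub>v (W *\<^sub>v u)) us)) = A * S' * B\<^sup>T"
  using assms
proof (induction us arbitrary: Q S R l)
  case Nil
  have S: "S \<in> carrier_mat k k" using Nil by (simp add: positive_singular_value_matrix_carrier)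
  have "hcat S (mat_of_cols k []) = S"
    using S by (auto simp: hcat_def intro!: eq_matI)
  then show ?case
    using Nil S by (intro exI[of _ "1\<^sub>m k"] exI[of _ S]) (auto simp: extend_right_0)
next
  case (Cons u us)
  let ?n = "length us"
  obtain Q1 S1 R1 where upd: "single_column_update W u (Q, S, R) (Q1, S1, R1)"
    and rest: "successive_updates W us (Q1, S1, R1) st"
    using Cons.prems(1) by auto
  obtain A B where A: "A \<in> carrier_mat k k" "A\<^sup>T * A = 1\<^sub>m k"
    and B: "B \<in> carrier_mat (k + 1) k" "B\<^sup>T * B = 1\<^sub>m k" and S1: "positive_singular_value_matrix k S1"
    and fac: "hcat S (mat_of_cols k [Q\<^sup>T *\<^sub>v (W *\<^sub>v u)]) = A * S1 * B\<^sup>T"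
    and new: "Q1 = Q * A" "R1 = extend_right 1 R * B"
    using single_column_update_thin_svd[OF upd Cons.prems(3,5)] by metis
  have R1: "R1 \<in> carrier_mat (l + 1) k"
    unfolding new using extend_right_carrier[OF Cons.prems(4), of 1] B by auto
  have Q1: "Q1 \<in> carrier_mat m k" unfolding new using Cons.prems(3) A by auto
  obtain A' S' B' where ih: "st = (Q1 * A', S', extend_right ?n R1 * B')"
    "A' \<in> carrier_mat k k" "A'\<^sup>T * A' = 1\<^sub>m k" "B' \<in> carrier_mat (k + ?n) k" "B'\<^sup>T * B' = 1\<^sub>m k"
    "positive_singular_value_matrix k S'"
    "hcat S1 (mat_of_cols k (map (\<lambda>u. Q1\<^sup>T *\<^sub>v (W *\<^sub>v u)) us)) = A' * S' * B'\<^sup>T"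
    using Cons.IH[OF rest Cons.prems(2) Q1 R1 S1] Cons.prems(6) by auto
  define E where "E = extend_right ?n B"
  have E: "E \<in> carrier_mat (k + 1 + ?n) (k + ?n)" "E\<^sup>T * E = 1\<^sub>m (k + ?n)"
    using extend_right_carrier[OF B(1)] extend_right_orthonormal[OF B] by (auto simp: E_def)
  have S1c: "S1 \<in> carrier_mat k k" and S'c: "S' \<in> carrier_mat k k" and Sc: "S \<in> carrier_mat k k"
    using S1 ih(6) Cons.prems(5) by (auto simp: positive_singular_value_matrix_carrier)
  note [simp] = carrier_matD[OF A(1)] carrier_matD[OF E(1)] carrier_matD[OF ih(2)]
    carrier_matD[OF ih(4)] carrier_matD[OF S'c] carrier_matD[OF B(1)] carrier_matD[OF Cons.prems(3)]
    carrier_matD[OF extend_right_carrier[OF Cons.prems(4)]]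
  let ?D = "mat_of_cols k (map (\<lambda>u. Q\<^sup>T *\<^sub>v (W *\<^sub>v u)) us)"
  have "hcat S (mat_of_cols k (map (\<lambda>u. Q\<^sup>T *\<^sub>v (W *\<^sub>v u)) (u # us))) = hcat (A * S1 * B\<^sup>T) ?D"
    unfolding list.map fac[symmetric] by (rule hcat_cons[OF Sc])
  also have "\<dots> = A * hcat S1 (A\<^sup>T * ?D) * E\<^sup>T"
    unfolding E_def by (rule hcat_factor[OF A S1c B(1) mat_of_cols_carrier(1)[of k "map _ us", unfolded length_map]])
  also have "A\<^sup>T * ?D = mat_of_cols k (map (\<lambda>u. Q1\<^sup>T *\<^sub>v (W *\<^sub>v u)) us)"
    unfolding new
    by (rule transpose_mult_mat_of_cols[OF A(1) Cons.prems(3)]) (use Cons.prems(2,6) in auto)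
  also have "A * hcat S1 \<dots> * E\<^sup>T = (A * A') * S' * (E * B')\<^sup>T"
    unfolding ih(7) by (simp add: mat_dim_simps)
  finally have final: "hcat S (mat_of_cols k (map (\<lambda>u. Q\<^sup>T *\<^sub>v (W *\<^sub>v u)) (u # us)))
    = (A * A') * S' * (E * B')\<^sup>T" .
  have "extend_right ?n R1 = extend_right (Suc ?n) R * E"
    unfolding new E_def
    using extend_right_mult[OF extend_right_carrier[OF Cons.prems(4), of 1] B(1), of ?n]
    by (simp add: extend_right_extend_right)
  then have "st = (Q * (A * A'), S', extend_right (length (u # us)) R * (E * B'))"
    by (simp add: ih(1) new(1) mat_dim_simps)
  moreover have "(A * A')\<^sup>T * (A * A') = 1\<^sub>m k" "(E * B')\<^sup>T * (E * B') = 1\<^sub>m k"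
    by (rule orthogonal_mult[OF A(1) ih(2) A(2) ih(3)] orthogonal_mult[OF E(1) ih(4) E(2) ih(5)])+
  moreover have "A * A' \<in> carrier_mat k k" "E * B' \<in> carrier_mat (k + length (u # us)) k"
    using A E ih by auto
  ultimately show ?case using ih(6) final by blast
qed

text \<open>
  The singular values stay positive after each update, so the next update again starts from an
  admissible state.
\<close>
lemma successive_updates_exist:
  assumes "Q \<in> carrier_mat m k" "positive_singular_value_matrix k S"
  shows "\<exists>st. successive_updates W us (Q, S, R) st"
  using assms
proof (induction us arbitrary: Q S R)
  case (Cons u us)
  obtain Q1 S1 R1 where upd: "single_column_update W u (Q, S, R) (Q1, S1, R1)"
    using single_column_update_exists[OF Cons.prems(1) positive_singular_value_matrix_carrier[OF Cons.prems(2)], of W u R]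
    by (metis prod_cases3)
  obtain A B where "A \<in> carrier_mat k k" "Q1 = Q * A" "positive_singular_value_matrix k S1"
    using single_column_update_thin_svd[OF upd Cons.prems] by metis
  then have "\<exists>st. successive_updates W us (Q1, S1, R1) st"
    using Cons.IH[of Q1 S1 R1] Cons.prems(1) by auto
  then show ?case using upd unfolding successive_updates.simps by blast
qed auto

section \<open>Uniqueness of the thin singular value decomposition\<close>

text \<open>
  Sorting a multiset has a unique result.
\<close>
lemma antimono_eq_if_permuted:
  fixes \<sigma> \<tau> :: "nat \<Rightarrow> real"
  assumes p: "p permutes {0..<k}" and eq: "\<And>i. i < k \<Longrightarrow> \<sigma> i = \<tau> (p i)"
    and \<sigma>: "\<And>i j. i \<le> j \<Longrightarrow> j < k \<Longrightarrow> \<sigma> j \<le> \<sigma> i"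
    and \<tau>: "\<And>i j. i \<le> j \<Longrightarrow> j < k \<Longrightarrow> \<tau> j \<le> \<tau> i" and i: "i < k"
  shows "\<sigma> i = \<tau> i"
proof -
  let ?l = "\<lambda>f. rev (map f [0..<k])"
  have "image_mset \<sigma> (mset_set {0..<k}) = image_mset \<tau> (image_mset p (mset_set {0..<k}))"
    by (simp add: multiset.map_comp o_def) (rule image_mset_cong, simp add: eq)
  also have "image_mset p (mset_set {0..<k}) = mset_set {0..<k}"
    using image_mset_mset_set[of p "{0..<k}"] permutes_inj_on[OF p] permutes_image[OF p] by simp
  finally have "mset (?l \<sigma>) = mset (?l \<tau>)" by simp
  moreover have "sorted (?l \<sigma>)" "sorted (?l \<tau>)"
    using \<sigma> \<tau> by (auto simp: sorted_rev_iff_nth_mono)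
  ultimately have "?l \<sigma> = ?l \<tau>" by (metis properties_for_sort)
  then show ?thesis using i by simp
qed

text \<open>
  Both \<open>r\<close> and \<open>k\<close> are the sum of the squares of all entries of \<open>M\<close>.
\<close>
lemma orthogonal_rectangular_imp_square:
  fixes M :: "real mat"
  assumes M: "M \<in> carrier_mat k r" and "M\<^sup>T * M = 1\<^sub>m r" "M * M\<^sup>T = 1\<^sub>m k"
  shows "r = k"
proof -
  have "real r = (\<Sum>j<r. (M\<^sup>T * M) $$ (j, j))" using assms by simp
  also have "\<dots> = (\<Sum>j<r. \<Sum>i<k. M $$ (i, j) * M $$ (i, j))"
    using M by (simp add: scalar_prod_def lessThan_atLeast0)
  also have "\<dots> = (\<Sum>i<k. \<Sum>j<r. M $$ (i, j) * M $$ (i, j))" by (rule sum.swap)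
  also have "\<dots> = (\<Sum>i<k. (M * M\<^sup>T) $$ (i, i))"
    using M by (simp add: scalar_prod_def lessThan_atLeast0)
  also have "\<dots> = real k" using assms by simp
  finally show ?thesis by simp
qed

text \<open>
  The matrix that links the two decompositions is \<open>P = M\<^sup>T\<close> for \<open>M = A\<^sup>T Qt\<close>. The two expressions for
  \<open>Y Y\<^sup>T\<close> give \<open>M St\<^sup>2 M\<^sup>T = S\<^sup>2\<close>. Since \<open>S\<close> is invertible, \<open>M\<close> has a right inverse besides the left
  inverse \<open>M\<^sup>T\<close>; so \<open>M\<close> is orthogonal, the two ranks agree, and \<open>M St\<^sup>2 = S\<^sup>2 M\<close>. Entrywise this says
  that \<open>M\<close> can be nonzero only at places where the singular values of both sides coincide. As
  \<open>det M\<close> is nonzero, some permutation avoids the zeros of \<open>M\<close> and matches the singular values,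
  and their ordering forces \<open>St = S\<close>. The same zero pattern makes \<open>M\<close> commute with \<open>S\<close>. The right
  factors are determined by the left ones through \<open>S B\<^sup>T = A\<^sup>T Y\<close>.
\<close>
lemma full_row_rank_thin_svd_unique:
  assumes A: "A \<in> carrier_mat k k" "A\<^sup>T * A = 1\<^sub>m k" and B: "B \<in> carrier_mat n k" "B\<^sup>T * B = 1\<^sub>m k"
    and S: "positive_singular_value_matrix k S" and Y: "Y = A * S * B\<^sup>T"
    and svd: "thin_svd Y (Qt, St, Rt)"
  obtains P where "Qt \<in> carrier_mat k k" "Rt \<in> carrier_mat n k" "St = S"
    "P \<in> carrier_mat k k" "P\<^sup>T * P = 1\<^sub>m k" "P * S = S * P" "A = Qt * P" "B = Rt * P"
proof -
  obtain \<sigma> where \<sigma>: "S = mat_diag k \<sigma>" "\<And>i. i < k \<Longrightarrow> 0 < \<sigma> i"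
    "\<And>i j. i \<le> j \<Longrightarrow> j < k \<Longrightarrow> \<sigma> j \<le> \<sigma> i"
    using positive_singular_value_matrixE[OF S] by blast
  have Sc: "S \<in> carrier_mat k k" by (simp add: \<sigma>(1))
  have Yc: "dim_row Y = k" "dim_col Y = n" using A B by (auto simp: Y)
  obtain r where Q: "Qt \<in> carrier_mat k r" and R: "Rt \<in> carrier_mat n r"
    and QQ: "Qt\<^sup>T * 1\<^sub>m k * Qt = 1\<^sub>m r" and RR: "Rt\<^sup>T * Rt = 1\<^sub>m r"
    and St: "positive_singular_value_matrix r St" and Yt: "Y = Qt * St * Rt\<^sup>T"
    using svd unfolding thin_svd_def weighted_thin_svd_def Yc by auto
  have QQ: "Qt\<^sup>T * Qt = 1\<^sub>m r" using QQ Q by simp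
  obtain \<tau> where \<tau>: "St = mat_diag r \<tau>" "\<And>i. i < r \<Longrightarrow> 0 < \<tau> i"
    "\<And>i j. i \<le> j \<Longrightarrow> j < r \<Longrightarrow> \<tau> j \<le> \<tau> i"
    using positive_singular_value_matrixE[OF St] by blast
  have Stc: "St \<in> carrier_mat r r" by (simp add: \<tau>(1))
  define I where "I = mat_diag k (\<lambda>i. 1 / \<sigma> i)"
  have Ic: "I \<in> carrier_mat k k" by (simp add: I_def)
  have "I * S = mat_diag k (\<lambda>i. 1)" "S * I = mat_diag k (\<lambda>i. 1)"
    unfolding I_def \<sigma>(1) mat_diag_diag
    by (rule eq_matI; use \<sigma>(2) in \<open>force simp: mat_diag_def\<close>)+
  then have IS: "I * S = 1\<^sub>m k" "S * I = 1\<^sub>m k" by simp_all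
  note AA = orthogonal_right_inverse[OF A]
  have sym: "S\<^sup>T = S" "St\<^sup>T = St" unfolding \<sigma>(1) \<tau>(1) by (rule transpose_mat_diag)+
  note [simp] = carrier_matD[OF A(1)] carrier_matD[OF B(1)] carrier_matD[OF Q] carrier_matD[OF R]
    carrier_matD[OF Sc] carrier_matD[OF Stc] carrier_matD[OF Ic]
  define M where "M = A\<^sup>T * Qt"
  have M: "M \<in> carrier_mat k r" unfolding M_def by (rule mult_carrier_mat[OF transpose_carrier_mat[THEN iffD2, OF A(1)] Q])
  note [simp] = carrier_matD[OF M]
  have MtM: "M\<^sup>T * M = 1\<^sub>m r" using AA QQ by (simp add: M_def mat_dim_simps)
  have "A\<^sup>T * (Y * Y\<^sup>T) * A = S * S"
    unfolding Y using A(2) B(2) sym by (simp add: mat_dim_simps)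
  moreover have "A\<^sup>T * (Y * Y\<^sup>T) * A = M * (St * St) * M\<^sup>T"
    unfolding Yt M_def using RR sym by (simp add: mat_dim_simps)
  ultimately have gram: "M * (St * St) * M\<^sup>T = S * S" by simp
  \<comment> \<open>\<open>Z\<close> is the right inverse of \<open>M\<close> read off from the Gram identity; it equals \<open>M\<^sup>T\<close>.\<close>
  define Z where "Z = St * St * M\<^sup>T * (I * I)"
  have Zc [simp]: "dim_row Z = r" "dim_col Z = k" by (simp_all add: Z_def)
  have "M * Z = S * S * (I * I)" unfolding gram[symmetric] Z_def by (simp add: mat_dim_simps)
  then have MZ: "M * Z = 1\<^sub>m k" using IS by (simp add: mat_dim_simps)
  have "Z = M\<^sup>T * (M * Z)" using MtM by (simp add: mat_dim_simps)
  then have "Z = M\<^sup>T" unfolding MZ using M by simp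
  then have MMt: "M * M\<^sup>T = 1\<^sub>m k" using MZ by simp
  have rk: "r = k" using orthogonal_rectangular_imp_square[OF M MtM MMt] .
  have "M * (St * St) = S * S * M"
    unfolding gram[symmetric] using MtM by (simp add: mat_dim_simps)
  then have entry: "M $$ (i, j) = 0 \<or> \<sigma> i = \<tau> j" if "i < k" "j < k" for i j
  proof -
    have "(M * (St * St)) $$ (i, j) = M $$ (i, j) * (\<tau> j)\<^sup>2"
      using that M rk by (simp add: \<tau>(1) mat_diag_mult_right[of _ k] power2_eq_square)
    moreover have "(S * S * M) $$ (i, j) = (\<sigma> i)\<^sup>2 * M $$ (i, j)"
      using that M rk by (simp add: \<sigma>(1) mat_diag_mult_left[of _ k k] power2_eq_square)
    ultimately have "M $$ (i, j) = 0 \<or> (\<sigma> i)\<^sup>2 = (\<tau> j)\<^sup>2"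
      using \<open>M * (St * St) = S * S * M\<close> by simp
    then show ?thesis using \<sigma>(2)[of i] \<tau>(2)[of j] that rk by (simp add: power2_eq_iff_nonneg less_imp_le)
  qed
  have Mk: "M \<in> carrier_mat k k" using M rk by simp
  have "det M * det (M\<^sup>T) = 1" using MMt det_mult[OF Mk, of "M\<^sup>T"] Mk by simp
  then have "det M \<noteq> 0" by auto
  then obtain p where p: "p permutes {0..<k}" "(\<Prod>i = 0..<k. M $$ (i, p i)) \<noteq> 0"
    unfolding det_def'[OF Mk] by (metis (no_types, lifting) mem_Collect_eq mult_zero_right sum.neutral)
  have perm: "\<sigma> i = \<tau> (p i)" if "i < k" for i
    using entry[of i "p i"] p(2) that permutes_in_image[OF p(1), of i] by auto
  have \<sigma>\<tau>: "\<sigma> i = \<tau> i" if "i < k" for i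
    by (rule antimono_eq_if_permuted[where \<sigma> = \<sigma> and \<tau> = \<tau>, OF p(1) perm _ _ that]) (blast intro: \<sigma>(3) \<tau>(3)[unfolded rk])+
  have StS: "St = S" unfolding \<sigma>(1) \<tau>(1) rk using \<sigma>\<tau> by (auto simp: mat_diag_def intro!: eq_matI)
  have MS: "M * S = S * M"
  proof (rule eq_matI)
    fix i j assume "i < dim_row (S * M)" "j < dim_col (S * M)"
    then have ij: "i < k" "j < k" using rk by auto
    have "(M * S) $$ (i, j) = M $$ (i, j) * \<sigma> j" "(S * M) $$ (i, j) = \<sigma> i * M $$ (i, j)"
      using ij Mk by (simp_all add: \<sigma>(1) mat_diag_mult_right[of _ k] mat_diag_mult_left[of _ k k])
    then show "(M * S) $$ (i, j) = (S * M) $$ (i, j)"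
      using entry[OF ij] \<sigma>\<tau>[OF ij(2)] by auto
  qed (use rk in auto)
  have PS: "M\<^sup>T * S = S * M\<^sup>T"
    using arg_cong[OF MS, of transpose_mat] sym rk by (simp add: mat_dim_simps)
  have "A = A * (M * M\<^sup>T)" unfolding MMt using A by simp
  then have A_eq: "A = Qt * M\<^sup>T" using AA by (simp add: M_def mat_dim_simps)
  have "S * B\<^sup>T = A\<^sup>T * Y" unfolding Y using A(2) by (simp add: mat_dim_simps)
  also have "\<dots> = M * S * Rt\<^sup>T" unfolding Yt StS M_def using rk by (simp add: mat_dim_simps)
  also have "\<dots> = S * (M * Rt\<^sup>T)" unfolding MS using rk by (simp add: mat_dim_simps)
  finally have "I * (S * B\<^sup>T) = I * (S * (M * Rt\<^sup>T))" by simp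
  then have "B\<^sup>T = M * Rt\<^sup>T" using IS by (simp add: mat_mult_cancel_dim)
  then have "B = (M * Rt\<^sup>T)\<^sup>T" by (metis transpose_transpose)
  then have B_eq: "B = Rt * M\<^sup>T" by (simp add: mat_dim_simps)
  show thesis
    using that[of "M\<^sup>T"] Q R StS MMt PS A_eq B_eq Mk unfolding rk by simp
qed

theorem theorem3p1:
  fixes m l k s :: nat and tol :: real
    and W Ul Q S R Y Qt St Rt :: "real mat"
    and u d :: "nat \<Rightarrow> real vec"
  assumes W: "spd m W"
    and tol: "tol > 0"
    and Ul: "Ul \<in> carrier_mat m l"
    and dims: "Q \<in> carrier_mat m k" "S \<in> carrier_mat k k" "R \<in> carrier_mat l k"
    and state: "truncated_weighted_thin_svd k W Ul (Q, S, R)"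
    and u_dim: "\<And>j. j \<in> {1..s} \<Longrightarrow> u (l + j) \<in> carrier_vec m"
    and u_res: "\<And>j. j \<in> {1..s} \<Longrightarrow>
           wnorm W (u (l + j) - Q *\<^sub>v (Q\<^sup>T *\<^sub>v (W *\<^sub>v u (l + j)))) \<le> tol"
    and d: "\<And>j. j \<in> {1..s} \<Longrightarrow> d j = Q\<^sup>T *\<^sub>v (W *\<^sub>v u (l + j))"
    and Y: "Y = hcat S (mat_of_cols k (map d [1..<s + 1]))"
    and svd: "thin_svd Y (Qt, St, Rt)"
  shows "(\<exists>st. successive_updates W (map (\<lambda>j. u (l + j)) [1..<s + 1]) (Q, S, R) st) \<and>
    (\<forall>st. successive_updates W (map (\<lambda>j. u (l + j)) [1..<s + 1]) (Q, S, R) st \<longrightarrow>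
       agree_up_to_svd_ambiguity k (Q * Qt, St, extend_right s R * Rt) st)"
proof -
  let ?us = "map (\<lambda>j. u (l + j)) [1..<s + 1]"
  have Wc: "W \<in> carrier_mat m m" using W by (simp add: spd_def)
  have S: "positive_singular_value_matrix k S"
    using state positive_singular_value_matrix_leading_block
    by (auto simp: truncated_weighted_thin_svd_def weighted_thin_svd_def)
  have us: "v \<in> carrier_vec m" if "v \<in> set ?us" for v
    using that u_dim by (auto simp: less_Suc_eq_le)
  have map_d: "map d [1..<s + 1] = map (\<lambda>v. Q\<^sup>T *\<^sub>v (W *\<^sub>v v)) ?us"
    using d by (auto simp: less_Suc_eq_le simp del: upt_Suc)
  have Y': "Y = hcat S (mat_of_cols k (map (\<lambda>v. Q\<^sup>T *\<^sub>v (W *\<^sub>v v)) ?us))"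
    unfolding Y map_d ..
  have len: "length ?us = s" by simp
  have "agree_up_to_svd_ambiguity k (Q * Qt, St, extend_right s R * Rt) st"
    if upd: "successive_updates W ?us (Q, S, R) st" for st
  proof -
    obtain A S' B where st: "st = (Q * A, S', extend_right s R * B)"
      and A: "A \<in> carrier_mat k k" "A\<^sup>T * A = 1\<^sub>m k"
      and B: "B \<in> carrier_mat (k + s) k" "B\<^sup>T * B = 1\<^sub>m k"
      and S': "positive_singular_value_matrix k S'" and fac: "Y = A * S' * B\<^sup>T"
      using successive_updates_thin_svd[OF upd Wc dims(1,3) S us, unfolded len, folded Y'] by blast
    obtain P where Qt: "Qt \<in> carrier_mat k k" and Rt: "Rt \<in> carrier_mat (k + s) k" and "St = S'"
      and P: "P \<in> carrier_mat k k" "P\<^sup>T * P = 1\<^sub>m k" "P * S' = S' * P" "A = Qt * P" "B = Rt * P"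
      using full_row_rank_thin_svd_unique[OF A B S' fac svd] by metis
    have "Q * A = Q * Qt * P" "extend_right s R * B = extend_right s R * Rt * P"
      using dims Qt Rt P extend_right_carrier[OF dims(3), of s]
      by (auto simp: mat_mult_assoc_dim)
    then show ?thesis
      using st \<open>St = S'\<close> S' P dims Qt Rt unfolding agree_up_to_svd_ambiguity_def by auto
  qed
  then show ?thesis using successive_updates_exist[OF dims(1) S] by blast
qed

end
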